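(* Let $G=(V,E)$ be a locally finite simple graph and let $x\in V$. For every $\mathcal N\in(0,\infty]$, $$\mathcal K_{G,x}(\mathcal N)\le 2+\frac{d_x-av_1(x)}{2}+\frac{\#_\Delta(x)}{d_x}-\frac{2d_x}{\mathcal N}.$$
   Context: Graphs are undirected, without loops or multiple edges, and every vertex has finite degree; $d_x$ is the degree of $x$, and the vertex $x$ considered has $d_x\ge1$. For $f:V\to\mathbb R$ put $\Delta f(x)=\sum_{y\sim x}(f(y)-f(x))$ (non-normalized Laplacian), and for $f,g:V\to\mathbb R$ put $2\Gamma(f,g)=\Delta(fg)-f\Delta g-g\Delta f$, $2\Gamma_2(f,g)=\Delta\Gamma(f,g)-\Gamma(f,\Delta g)-\Gamma(\Delta f,g)$, $\Gamma(f)=\Gamma(f,f)$, $\Gamma_2(f)=\Gamma_2(f,f)$. For $\mathcal N\in(0,\infty]$ (convention $1/\infty=0$), $\mathcal K_{G,x}(\mathcal N)$ is the largest $K\in\mathbb R$ such that $\Gamma_2(f)(x)\ge\frac1{\mathcal N}(\Delta f(x))^2+K\,\Gamma(f)(x)$ for all $f:V\to\mathbb R$ (Bakry-Émery curvature function). $S_1(x)$ is the set of neighbours of $x$; $av_1(x)=\frac1{d_x}\sum_{y\in S_1(x)}d_y$ is the average degree of the neighbours of $x$; $\#_\Delta(x)$ is the number of triangles (3-cycles) of $G$ containing $x$. *)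

theory Defs
  imports Complex_Main "HOL-Library.Extended_Real"
begin

text \<open>
  A graph is given by its adjacency relation; its vertex set is the whole type \<open>'v\<close>,
  which may be infinite.
\<close>

definition neighbours :: "('v \<Rightarrow> 'v \<Rightarrow> bool) \<Rightarrow> 'v \<Rightarrow> 'v set" where
  "neighbours E x = {y. E x y}"

definition locally_finite_simple_graph :: "('v \<Rightarrow> 'v \<Rightarrow> bool) \<Rightarrow> bool" where
  "locally_finite_simple_graph E \<longleftrightarrow> symp E \<and> irreflp E \<and> (\<forall>x. finite (neighbours E x))"

definition vdegree :: "('v \<Rightarrow> 'v \<Rightarrow> bool) \<Rightarrow> 'v \<Rightarrow> nat" where
  "vdegree E x = card (neighbours E x)"

definition av1 :: "('v \<Rightarrow> 'v \<Rightarrow> bool) \<Rightarrow> 'v \<Rightarrow> real" where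
  "av1 E x = (\<Sum>y\<in>neighbours E x. real (vdegree E y)) / real (vdegree E x)"

definition triangles_at :: "('v \<Rightarrow> 'v \<Rightarrow> bool) \<Rightarrow> 'v \<Rightarrow> 'v set set" where
  "triangles_at E x = {T. x \<in> T \<and> card T = 3 \<and> (\<forall>y\<in>T. \<forall>z\<in>T. y \<noteq> z \<longrightarrow> E y z)}"

definition laplacian :: "('v \<Rightarrow> 'v \<Rightarrow> bool) \<Rightarrow> ('v \<Rightarrow> real) \<Rightarrow> 'v \<Rightarrow> real" where
  "laplacian E f x = (\<Sum>y\<in>neighbours E x. f y - f x)"

definition Gam :: "('v \<Rightarrow> 'v \<Rightarrow> bool) \<Rightarrow> ('v \<Rightarrow> real) \<Rightarrow> ('v \<Rightarrow> real) \<Rightarrow> 'v \<Rightarrow> real" where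
  "Gam E f g x =
    (laplacian E (\<lambda>y. f y * g y) x - f x * laplacian E g x - g x * laplacian E f x) / 2"

definition Gam2 :: "('v \<Rightarrow> 'v \<Rightarrow> bool) \<Rightarrow> ('v \<Rightarrow> real) \<Rightarrow> ('v \<Rightarrow> real) \<Rightarrow> 'v \<Rightarrow> real" where
  "Gam2 E f g x =
    (laplacian E (Gam E f g) x - Gam E f (laplacian E g) x - Gam E (laplacian E f) g x) / 2"

definition curvature_dimension ::
    "('v \<Rightarrow> 'v \<Rightarrow> bool) \<Rightarrow> 'v \<Rightarrow> ereal \<Rightarrow> real \<Rightarrow> bool" where
  "curvature_dimension E x N K \<longleftrightarrow>
    (\<forall>f. Gam2 E f f x \<ge> real_of_ereal (1 / N) * (laplacian E f x)\<^sup>2 + K * Gam E f f x)"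

text \<open>
  The dimension parameter ranges over \<open>0 < N \<le> \<infinity>\<close>, with \<open>1 / \<infinity> = 0\<close> as in \<open>ereal\<close>.
  The largest \<open>K\<close> exists whenever \<open>x\<close> has a neighbour; for an isolated vertex every \<open>K\<close>
  is admissible and the value below is unspecified.
\<close>

definition curvature :: "('v \<Rightarrow> 'v \<Rightarrow> bool) \<Rightarrow> 'v \<Rightarrow> ereal \<Rightarrow> real" where
  "curvature E x N = (GREATEST K. curvature_dimension E x N K)"

end

theory Submission
  imports Defs "HOL-Analysis.Convex"
begin

text \<open>
  Expanding the definitions gives
  \<open>4\<Gamma>\<^sub>2(f)(x) = \<Sum>\<^bsub>y\<sim>x\<^esub> \<Sum>\<^bsub>z\<sim>y\<^esub> (u\<^sup>2 - 2uv) + 2(\<Delta>f(x))\<^sup>2 - 2d\<^sub>x\<Gamma>(f)(x)\<close> with \<open>u = f(z) - f(y)\<close> and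
  \<open>v = f(y) - f(x)\<close>. Since \<open>u\<^sup>2 - 2uv \<ge> -v\<^sup>2\<close>, some \<open>K\<close> is admissible, so the largest
  admissible \<open>K\<close> exists as soon as these are bounded above. The bound is what the
  curvature-dimension inequality says for the distance from \<open>x\<close> truncated at 2: there an edge
  from \<open>y \<in> S\<^sub>1(x)\<close> back to \<open>x\<close> contributes 3, an edge inside \<open>S\<^sub>1(x)\<close> contributes 0,
  an outward edge contributes -1, and each triangle at \<open>x\<close> accounts for two of the ordered
  edges inside \<open>S\<^sub>1(x)\<close>.
\<close>

lemma Gam_eq:
  "Gam E f g x = (\<Sum>y\<in>neighbours E x. (f y - f x) * (g y - g x)) / 2"
  unfolding Gam_def laplacian_def
  by (simp add: sum_distrib_left flip: sum_subtractf) (simp add: algebra_simps)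

lemma Gam_same_eq: "Gam E f f x = (\<Sum>y\<in>neighbours E x. (f y - f x)\<^sup>2) / 2"
  by (simp add: Gam_eq power2_eq_square)

lemma Gam_nonneg: "Gam E f f x \<ge> 0"
  by (simp add: Gam_same_eq sum_nonneg)

text \<open>The double sum gathers \<open>Gam E f f\<close> and \<open>laplacian E f\<close> at the
  neighbours of \<open>x\<close>. The last two terms come from the values at \<open>x\<close>
  itself, which the differences in \<open>laplacian E (Gam E f f) x\<close> and
  \<open>Gam E f (laplacian E f) x\<close> subtract.\<close>

lemma Gam2_eq:
  "4 * Gam2 E f f x =
    (\<Sum>y\<in>neighbours E x. \<Sum>z\<in>neighbours E y. (f z - f y)\<^sup>2 - 2 * (f z - f y) * (f y - f x))
    + 2 * (laplacian E f x)\<^sup>2 - 2 * real (vdegree E x) * Gam E f f x"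
proof -
  let ?S = "neighbours E"
  have inner: "(\<Sum>z\<in>?S y. (f z - f y)\<^sup>2 - 2 * (f z - f y) * (f y - f x))
      = 2 * Gam E f f y - 2 * (f y - f x) * laplacian E f y" for y
  proof -
    have "(\<Sum>z\<in>?S y. (f z - f y)\<^sup>2) = 2 * Gam E f f y"
      by (simp add: Gam_same_eq)
    moreover have "(\<Sum>z\<in>?S y. 2 * (f z - f y) * (f y - f x))
        = 2 * (f y - f x) * laplacian E f y"
      unfolding laplacian_def sum_distrib_left by (intro sum.cong refl) (simp only: mult_ac)
    ultimately show ?thesis
      by (simp only: sum_subtractf)
  qed
  have "4 * Gam2 E f f x = 2 * laplacian E (Gam E f f) x - 4 * Gam E f (laplacian E f) x"
    by (simp add: Gam2_def Gam_eq mult.commute)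
  also have "2 * laplacian E (Gam E f f) x
      = (\<Sum>y\<in>?S x. 2 * Gam E f f y) - 2 * real (vdegree E x) * Gam E f f x"
    by (simp add: laplacian_def sum_subtractf sum_distrib_left vdegree_def algebra_simps)
  also have "4 * Gam E f (laplacian E f) x
      = (\<Sum>y\<in>?S x. 2 * (f y - f x) * laplacian E f y)
        - 2 * (\<Sum>y\<in>?S x. (f y - f x)) * laplacian E f x"
  proof -
    have "4 * Gam E f (laplacian E f) x
        = 2 * (\<Sum>y\<in>?S x. (f y - f x) * (laplacian E f y - laplacian E f x))"
      by (simp add: Gam_eq)
    then show ?thesis
      unfolding sum_distrib_left sum_distrib_right sum_subtractf[symmetric]
      by (simp add: algebra_simps)
  qed
  also have "(\<Sum>y\<in>?S x. f y - f x) = laplacian E f x"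
    by (simp add: laplacian_def)
  finally show ?thesis
    unfolding inner by (simp add: sum_subtractf power2_eq_square)
qed

text \<open>Cauchy-Schwarz against the constant 1; it lets a multiple of \<open>Gam E f f x\<close>
  absorb the dimension term.\<close>

lemma laplacian_square_le:
  "(laplacian E f x)\<^sup>2 \<le> 2 * real (vdegree E x) * Gam E f f x"
  using sum_squared_le_sum_of_squares[of "\<lambda>y. f y - f x" "neighbours E x"]
  by (simp add: laplacian_def Gam_same_eq vdegree_def mult.commute)

lemma Gam2_lower_bound:
  assumes fin: "finite (neighbours E x)"
  shows "Gam2 E f f x \<ge>
    - ((\<Sum>y\<in>neighbours E x. real (vdegree E y)) + real (vdegree E x)) / 2 * Gam E f f x"
proof -
  let ?S = "neighbours E"
  let ?D = "\<Sum>y\<in>?S x. real (vdegree E y)"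
  have inner: "(\<Sum>z\<in>?S y. (f z - f y)\<^sup>2 - 2 * (f z - f y) * (f y - f x))
      \<ge> - ?D * (f y - f x)\<^sup>2" if y: "y \<in> ?S x" for y
  proof -
    have "(f z - f y)\<^sup>2 - 2 * (f z - f y) * (f y - f x) \<ge> - (f y - f x)\<^sup>2" for z
      using zero_le_power2[of "(f z - f y) - (f y - f x)"]
      by (simp only: power2_diff)
    then have "(\<Sum>z\<in>?S y. (f z - f y)\<^sup>2 - 2 * (f z - f y) * (f y - f x))
        \<ge> (\<Sum>z\<in>?S y. - (f y - f x)\<^sup>2)"
      by (intro sum_mono)
    \<comment> \<open>Replacing the degree of \<open>y\<close> by the sum over all neighbours makes
      the constant independent of \<open>y\<close>, so it can be pulled out of the outer
      sum.\<close>
    moreover have "real (vdegree E y) \<le> ?D"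
      using fin y by (intro member_le_sum) auto
    then have "real (vdegree E y) * (f y - f x)\<^sup>2 \<le> ?D * (f y - f x)\<^sup>2"
      by (intro mult_right_mono) auto
    ultimately show ?thesis
      by (simp add: vdegree_def)
  qed
  have "(\<Sum>y\<in>?S x. - ?D * (f y - f x)\<^sup>2)
      \<le> (\<Sum>y\<in>?S x. \<Sum>z\<in>?S y. (f z - f y)\<^sup>2 - 2 * (f z - f y) * (f y - f x))"
    by (intro sum_mono inner)
  moreover have "(\<Sum>y\<in>?S x. - ?D * (f y - f x)\<^sup>2) = - 2 * ?D * Gam E f f x"
    unfolding Gam_same_eq sum_distrib_left[symmetric] by simp
  ultimately have "4 * Gam2 E f f x \<ge> - 2 * ?D * Gam E f f x - 2 * real (vdegree E x) * Gam E f f x"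
    using zero_le_power2[of "laplacian E f x"] unfolding Gam2_eq by linarith
  then show ?thesis
    by (simp add: algebra_simps)
qed

lemma curvature_dimension_exists:
  assumes fin: "finite (neighbours E x)"
  shows "\<exists>K. curvature_dimension E x N K"
proof -
  let ?c = "real_of_ereal (1 / N)"
  let ?D = "(\<Sum>y\<in>neighbours E x. real (vdegree E y)) + real (vdegree E x)"
  have "Gam2 E f f x \<ge> ?c * (laplacian E f x)\<^sup>2
      + (- ?D / 2 - 2 * \<bar>?c\<bar> * real (vdegree E x)) * Gam E f f x" for f
  proof -
    \<comment> \<open>\<open>N\<close> is arbitrary here, so the sign of \<open>?c\<close> is
      unknown.\<close>
    have "?c * (laplacian E f x)\<^sup>2 \<le> \<bar>?c\<bar> * (laplacian E f x)\<^sup>2"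
      by (intro mult_right_mono abs_ge_self zero_le_power2)
    also have "\<dots> \<le> \<bar>?c\<bar> * (2 * real (vdegree E x) * Gam E f f x)"
      by (intro mult_left_mono laplacian_square_le abs_ge_zero)
    finally show ?thesis
      using Gam2_lower_bound[OF fin, of f] by (simp add: field_simps)
  qed
  then show ?thesis
    unfolding curvature_dimension_def by blast
qed

text \<open>\<open>GREATEST\<close> has a specified value only if a maximum exists. For fixed
  \<open>f\<close> admissibility is a linear inequality in \<open>K\<close>, hence survives passing
  to the supremum, which is therefore attained.\<close>

lemma curvature_le:
  assumes fin: "finite (neighbours E x)"
    and bound: "\<And>K. curvature_dimension E x N K \<Longrightarrow> K \<le> B"
  shows "curvature E x N \<le> B"
proof -
  let ?A = "{K. curvature_dimension E x N K}"
  obtain K0 where K0: "K0 \<in> ?A"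
    using curvature_dimension_exists[OF fin] by auto
  have bdd: "bdd_above ?A"
    using bound by (auto intro: bdd_aboveI[of _ B])
  have "curvature_dimension E x N (Sup ?A)"
    unfolding curvature_dimension_def[of E x N "Sup ?A"]
  proof
    fix f
    let ?R = "Gam2 E f f x - real_of_ereal (1 / N) * (laplacian E f x)\<^sup>2"
    have le: "K * Gam E f f x \<le> ?R" if "K \<in> ?A" for K
      using that by (simp add: curvature_dimension_def algebra_simps)
    have "Sup ?A * Gam E f f x \<le> ?R"
    proof (cases "Gam E f f x = 0")
      \<comment> \<open>The inequality no longer involves \<open>K\<close>, so any admissible
        \<open>K0\<close> yields it.\<close>
      case True
      then show ?thesis
        using le[OF K0] by simp
    next
      case False
      then have pos: "Gam E f f x > 0"
        using Gam_nonneg[of E f x] by simp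
      then have "Sup ?A \<le> ?R / Gam E f f x"
        using K0 le by (intro cSup_least) (auto simp: pos_le_divide_eq)
      with pos show ?thesis
        by (simp add: pos_le_divide_eq)
    qed
    then show "real_of_ereal (1 / N) * (laplacian E f x)\<^sup>2 + Sup ?A * Gam E f f x \<le> Gam2 E f f x"
      by simp
  qed
  moreover have "curvature E x N = Sup ?A"
    unfolding curvature_def
  proof (rule Greatest_equality)
    show "curvature_dimension E x N (Sup ?A)" by fact
  qed (use bdd in \<open>auto intro: cSup_upper\<close>)
  ultimately show ?thesis
    using bound by simp
qed

text \<open>The left side counts ordered pairs (y, z) of adjacent neighbours of \<open>x\<close>.
  Such a pair is sent to the triangle {x, y, z}, and each fibre has at most two elements.\<close>

lemma sum_common_neighbours_le:
  assumes G: "locally_finite_simple_graph E"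
  shows "(\<Sum>y\<in>neighbours E x. card (neighbours E y \<inter> neighbours E x))
    \<le> 2 * card (triangles_at E x)"
proof -
  let ?S = "neighbours E"
  let ?P = "SIGMA y:?S x. ?S y \<inter> ?S x"
  let ?fib = "\<lambda>T. {p \<in> ?P. {x, fst p, snd p} = T}"
  have fin: "finite (?S y)" and irr: "\<not> E y y" and sym: "E y z \<Longrightarrow> E z y" for y z
    using G by (auto simp: locally_finite_simple_graph_def irreflp_def dest: sympD)
  have finP: "finite ?P"
    using fin by auto
  have "triangles_at E x \<subseteq> Pow (insert x (?S x))"
    by (auto simp: triangles_at_def neighbours_def)
  then have finT: "finite (triangles_at E x)"
    by (rule finite_subset) (simp add: fin)
  have tri: "{x, y, z} \<in> triangles_at E x" if "(y, z) \<in> ?P" for y z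
  proof -
    from that have "E x y" "E y z" "E x z"
      by (auto simp: neighbours_def)
    moreover from this have "x \<noteq> y" "y \<noteq> z" "x \<noteq> z"
      using irr by auto
    ultimately show ?thesis
      using sym by (auto simp: triangles_at_def)
  qed
  have fib: "card (?fib T) \<le> 2" for T
  proof (cases "?fib T = {}")
    case False
    then obtain a b where ab: "(a, b) \<in> ?P" "{x, a, b} = T"
      by auto
    \<comment> \<open>The entries of any pair in the fibre are distinct, differ from
      \<open>x\<close> and lie in {x, a, b}, which leaves only (a, b) and its swap.\<close>
    have "?fib T \<subseteq> {(a, b), (b, a)}"
    proof
      fix p
      assume p: "p \<in> ?fib T"
      obtain y z where yz: "p = (y, z)"
        by (cases p)
      have "E x y" "E x z" "E y z"
        using p by (simp_all add: yz neighbours_def)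
      then have "x \<noteq> y" "x \<noteq> z" "y \<noteq> z"
        using irr by metis+
      moreover have "y \<in> {x, a, b}" "z \<in> {x, a, b}"
        unfolding ab(2) using p by (auto simp only: yz fst_conv snd_conv)
      ultimately show "p \<in> {(a, b), (b, a)}"
        unfolding yz by auto
    qed
    then have "card (?fib T) \<le> card {(a, b), (b, a)}"
      by (intro card_mono) auto
    also have "\<dots> \<le> 2"
      by (cases "a = b") auto
    finally show ?thesis .
  next
    case True
    show ?thesis
      unfolding True by simp
  qed
  have "(\<Sum>y\<in>?S x. card (?S y \<inter> ?S x)) = card ?P"
    using fin by simp
  also have "\<dots> \<le> card (\<Union>T\<in>triangles_at E x. ?fib T)"
  proof (rule card_mono)
    show "finite (\<Union>T\<in>triangles_at E x. ?fib T)"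
      by (rule finite_subset[OF _ finP]) blast
    show "?P \<subseteq> (\<Union>T\<in>triangles_at E x. ?fib T)"
    proof
      fix p
      assume p: "p \<in> ?P"
      then have "{x, fst p, snd p} \<in> triangles_at E x"
        by (intro tri) simp
      with p show "p \<in> (\<Union>T\<in>triangles_at E x. ?fib T)"
        by blast
    qed
  qed
  also have "\<dots> \<le> (\<Sum>T\<in>triangles_at E x. card (?fib T))"
    by (rule card_UN_le[OF finT])
  also have "\<dots> \<le> (\<Sum>T\<in>triangles_at E x. 2)"
    by (intro sum_mono fib)
  finally show ?thesis
    by simp
qed

lemma curvature_dimension_le:
  assumes G: "locally_finite_simple_graph E"
    and deg: "vdegree E x \<ge> 1"
    and cd: "curvature_dimension E x N K"
  shows "K \<le> 2 + (real (vdegree E x) - av1 E x) / 2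
      + real (card (triangles_at E x)) / real (vdegree E x)
      - 2 * real (vdegree E x) * real_of_ereal (1 / N)"
proof -
  let ?S = "neighbours E"
  define d where "d = real (vdegree E x)"
  define c where "c = real_of_ereal (1 / N)"
  define t where "t = (\<Sum>y\<in>?S x. real (card (?S y \<inter> ?S x)))"
  define f :: "_ \<Rightarrow> real" where "f z = (if z = x then 0 else if E x z then 1 else 2)" for z
  have fin: "finite (?S y)" and irr: "\<not> E y y" and sym: "E y z \<Longrightarrow> E z y" for y z
    using G by (auto simp: locally_finite_simple_graph_def irreflp_def dest: sympD)
  have d: "d > 0"
    using deg by (simp add: d_def)
  have fx: "f x = 0"
    by (simp add: f_def)
  have fy: "f y = 1" if "y \<in> ?S x" for y
    using that irr by (auto simp: f_def neighbours_def)
  have lap: "laplacian E f x = d"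
    by (simp add: laplacian_def fx fy d_def vdegree_def)
  have gam: "Gam E f f x = d / 2"
    by (simp add: Gam_same_eq fx fy d_def vdegree_def)
  have inner: "(\<Sum>z\<in>?S y. (f z - f y)\<^sup>2 - 2 * (f z - f y) * (f y - f x))
      = 4 - real (vdegree E y) + real (card (?S y \<inter> ?S x))" if y: "y \<in> ?S x" for y
  proof -
    have xy: "x \<in> ?S y"
      using y sym by (auto simp: neighbours_def)
    \<comment> \<open>Here v = 1, so u = -1, 0, 1 give 3, 0, -1. This is written as a baseline of -1
      plus 4 at \<open>x\<close> or 1 on \<open>?S x\<close>; the two corrections never overlap, as
      \<open>x\<close> is not its own neighbour.\<close>
    have "(\<Sum>z\<in>?S y. (f z - f y)\<^sup>2 - 2 * (f z - f y) * (f y - f x))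
        = (\<Sum>z\<in>?S y. (if z = x then 4 else 0) - 1 + (if z \<in> ?S x then 1 else 0))"
      using irr y by (intro sum.cong) (auto simp: fx fy[OF y] f_def neighbours_def)
    also have "\<dots> = 4 - real (vdegree E y) + real (card (?S y \<inter> ?S x))"
      using fin xy
      by (simp add: sum.distrib sum_subtractf vdegree_def flip: sum.inter_restrict)
    finally show ?thesis .
  qed
  have "(\<Sum>y\<in>?S x. 4 - real (vdegree E y) + real (card (?S y \<inter> ?S x))) = 4 * d - d * av1 E x + t"
    using d by (simp add: sum.distrib sum_subtractf av1_def d_def t_def vdegree_def)
  \<comment> \<open>The summand \<open>d\<^sup>2\<close> is what remains of
    \<open>2 * d\<^sup>2 - 2 * d * (d / 2)\<close>.\<close>
  then have "4 * Gam2 E f f x = 4 * d - d * av1 E x + t + d\<^sup>2"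
    unfolding Gam2_eq using inner by (simp add: lap gam power2_eq_square flip: d_def)
  moreover have "c * d\<^sup>2 + K * (d / 2) \<le> Gam2 E f f x"
    using cd unfolding curvature_dimension_def c_def by (metis lap gam)
  moreover have "t \<le> 2 * real (card (triangles_at E x))"
    using sum_common_neighbours_le[OF G, of x]
    unfolding t_def of_nat_sum[symmetric] by linarith
  \<comment> \<open>Twice the curvature-dimension inequality; \<open>t / 2\<close> is at most the
    number of triangles.\<close>
  ultimately have "K * d \<le> 2 * d + (d\<^sup>2 - d * av1 E x) / 2 + real (card (triangles_at E x)) - 2 * c * d\<^sup>2"
    by (simp add: field_simps)
  also have "\<dots> = (2 + (d - av1 E x) / 2 + real (card (triangles_at E x)) / d - 2 * d * c) * d"
    using d by (simp add: field_simps power2_eq_square)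
  finally show ?thesis
    using d by (simp add: d_def c_def)
qed

theorem theorem3p1:
  fixes E :: "'v \<Rightarrow> 'v \<Rightarrow> bool" and x :: 'v and N :: ereal
  assumes "locally_finite_simple_graph E"
    and "vdegree E x \<ge> 1"
    and "0 < N"
  shows "curvature E x N \<le>
    2 + (real (vdegree E x) - av1 E x) / 2
      + real (card (triangles_at E x)) / real (vdegree E x)
      - 2 * real (vdegree E x) * real_of_ereal (1 / N)"
proof (rule curvature_le)
  show "finite (neighbours E x)"
    using assms(1) by (simp add: locally_finite_simple_graph_def)
qed (rule curvature_dimension_le[OF assms(1,2)])

end
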